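(* Let $C=(c_{ij})$ and $C'=(c'_{ij})$ be real $n\times n$ matrices with row-sum vectors $(r_1,\ldots,r_n)$ and $(r'_1,\ldots,r'_n)$ respectively. Assume: (i) $c_{ij}\geq c'_{ij}$ for all $1\leq i\leq n$, $1\leq j\leq n-1$, and $r_i\geq r'_i$ for all $1\leq i\leq n$; (ii) $C'$ has a rooted eigenvector $v'=(v'_1,\ldots,v'_n)^T$ for an eigenvalue $\lambda'\in\mathbb{R}$; (iii) $C$ has a nonnegative left eigenvector $v^T=(v_1,\ldots,v_n)$ for an eigenvalue $\lambda\in\mathbb{R}$; (iv) $v^Tv'>0$. Then $\lambda\geq\lambda'$. Moreover, $\lambda=\lambda'$ if and only if both of the following hold: (a) if $v'_n\neq 0$, then $r_i=r'_i$ for all $1\le i\le n$ with $v_i\neq0$; (b) $c'_{ij}=c_{ij}$ for all $1\leq i\leq n$, $1\leq j\leq n-1$ with $v_i\neq 0$ and $v'_j>v'_n$.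
   Context: A real vector $(v_1,\ldots,v_n)$ is rooted if $v_i\geq v_n\geq 0$ for all $1\leq i\leq n-1$. The row-sum vector of a matrix is the vector of its row sums. *)

theory Defs
  imports "Jordan_Normal_Form.Char_Poly"
begin

text \<open>
  Vectors and matrices are indexed from 0, so the last coordinate of an \<open>n\<close>-dimensional
  vector is \<open>v $ (n - 1)\<close>.
\<close>

definition rooted :: "real vec \<Rightarrow> bool" where
  "rooted v \<longleftrightarrow>
     (\<forall>i < dim_vec v - 1. v $ i \<ge> v $ (dim_vec v - 1)) \<and> v $ (dim_vec v - 1) \<ge> 0"

definition row_sum_vec :: "'a :: comm_monoid_add mat \<Rightarrow> 'a vec" where
  "row_sum_vec A = vec (dim_row A) (\<lambda>i. \<Sum>j < dim_col A. A $$ (i, j))"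

definition vec_mult_mat :: "'a :: semiring_0 vec \<Rightarrow> 'a mat \<Rightarrow> 'a vec" where
  "vec_mult_mat v A = vec (dim_col A) (\<lambda>j. v \<bullet> col A j)"

definition left_eigenvector :: "'a :: comm_ring_1 mat \<Rightarrow> 'a vec \<Rightarrow> 'a \<Rightarrow> bool" where
  "left_eigenvector A v k \<longleftrightarrow>
     v \<in> carrier_vec (dim_row A) \<and> v \<noteq> 0\<^sub>v (dim_row A) \<and> vec_mult_mat v A = k \<cdot>\<^sub>v v"

definition nonneg_vec :: "real vec \<Rightarrow> bool" where
  "nonneg_vec v \<longleftrightarrow> (\<forall>i < dim_vec v. v $ i \<ge> 0)"

end

theory Submission
  imports Defs
begin

text \<open>
  Write \<open>w\<close> for the last entry of \<open>v'\<close>. Evaluating \<open>v\<^sup>T (C - C') v'\<close> in two ways gives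
  \<open>(l - l') (v \<bullet> v') = (\<Sum>i. v\<^sub>i (w (r\<^sub>i - r'\<^sub>i) + (\<Sum>j. (c\<^sub>i\<^sub>j - c'\<^sub>i\<^sub>j) (v'\<^sub>j - w))))\<close>, where the last
  column drops out of the inner sum, so every summand is nonnegative. Hence \<open>l \<ge> l'\<close>, with equality
  iff every summand vanishes.
\<close>

text \<open>The right-hand side is the bilinear form of \<open>A - B\<close> at \<open>x\<close> and
  \<open>y\<close>. In the \<open>A\<close> part, swapping the sums brings out column sums weighted
  by \<open>x\<close>, where the left eigenvector equation applies; in the \<open>B\<close> part the
  inner sums are already entries of the product of \<open>B\<close> with \<open>y\<close>.\<close>

lemma left_right_eigenvector_diff:
  fixes A B :: "'a :: comm_ring_1 mat"
  assumes A: "A \<in> carrier_mat n n" and B: "B \<in> carrier_mat n n"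
    and left: "left_eigenvector A x a" and right: "eigenvector B y b"
  shows "(a - b) * (x \<bullet> y) = (\<Sum>i<n. x $ i * (\<Sum>j<n. (A $$ (i, j) - B $$ (i, j)) * y $ j))"
proof -
  have x: "dim_vec x = n" "vec_mult_mat x A = a \<cdot>\<^sub>v x"
    using left A by (auto simp: left_eigenvector_def)
  have y: "dim_vec y = n" "B *\<^sub>v y = b \<cdot>\<^sub>v y"
    using right B by (auto simp: eigenvector_def)
  have lx: "(\<Sum>i<n. x $ i * A $$ (i, j)) = a * x $ j" if "j < n" for j
    using arg_cong[OF x(2), of "\<lambda>u. u $ j"] that x(1) A
    by (simp add: vec_mult_mat_def scalar_prod_def lessThan_atLeast0)
  have ry: "(\<Sum>j<n. B $$ (i, j) * y $ j) = b * y $ i" if "i < n" for i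
    using arg_cong[OF y(2), of "\<lambda>u. u $ i"] that y(1) B
    by (simp add: scalar_prod_def lessThan_atLeast0)
  have xy: "x \<bullet> y = (\<Sum>i<n. x $ i * y $ i)"
    using y(1) by (simp add: scalar_prod_def lessThan_atLeast0)
  have "(\<Sum>i<n. x $ i * (\<Sum>j<n. A $$ (i, j) * y $ j))
      = (\<Sum>j<n. (\<Sum>i<n. x $ i * A $$ (i, j)) * y $ j)"
    unfolding sum_distrib_left sum_distrib_right mult.assoc by (rule sum.swap)
  also have "\<dots> = a * (x \<bullet> y)"
    by (simp add: lx xy sum_distrib_left mult.assoc)
  finally have a: "(\<Sum>i<n. x $ i * (\<Sum>j<n. A $$ (i, j) * y $ j)) = a * (x \<bullet> y)" .
  have b: "(\<Sum>i<n. x $ i * (\<Sum>j<n. B $$ (i, j) * y $ j)) = b * (x \<bullet> y)"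
    by (simp add: ry xy sum_distrib_left mult.left_commute)
  show ?thesis
    by (simp add: left_diff_distrib right_diff_distrib sum_subtractf a b)
qed

text \<open>Writing \<open>u j\<close> as \<open>u m + (u j - u m)\<close> makes the term
  \<open>j = m\<close> of the second sum vanish. So \<open>d m\<close>, whose sign is unknown in the
  application, enters only through the total of \<open>d\<close>.\<close>

lemma sum_mult_shift_last:
  fixes d u :: "nat \<Rightarrow> 'a :: comm_ring_1"
  shows "(\<Sum>j<Suc m. d j * u j) = u m * (\<Sum>j<Suc m. d j) + (\<Sum>j<m. d j * (u j - u m))"
  by (simp add: algebra_simps sum_subtractf sum_distrib_left)

theorem theorem3p5:
  fixes n :: nat
    and C C' :: "real mat"
    and r r' v v' :: "real vec"
    and l l' :: real
  assumes "n \<ge> 1"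
    and "C \<in> carrier_mat n n"
    and "C' \<in> carrier_mat n n"
    and "r = row_sum_vec C"
    and "r' = row_sum_vec C'"
    and "\<forall>i < n. \<forall>j < n - 1. C $$ (i, j) \<ge> C' $$ (i, j)"
    and "\<forall>i < n. r $ i \<ge> r' $ i"
    and "eigenvector C' v' l'"
    and "rooted v'"
    and "left_eigenvector C v l"
    and "nonneg_vec v"
    and "v \<bullet> v' > 0"
  shows "l \<ge> l' \<and>
    (l = l' \<longleftrightarrow>
       (v' $ (n - 1) \<noteq> 0 \<longrightarrow> (\<forall>i < n. v $ i \<noteq> 0 \<longrightarrow> r $ i = r' $ i)) \<and>
       (\<forall>i < n. \<forall>j < n - 1. v $ i \<noteq> 0 \<and> v' $ j > v' $ (n - 1) \<longrightarrow> C' $$ (i, j) = C $$ (i, j)))"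
proof -
  \<comment> \<open>With 0-based indexing, \<open>m\<close> is both the index of the last coordinate
    and the number of columns in which the entries are compared.\<close>
  define m where "m = n - 1"
  have n: "n = Suc m" using assms(1) by (simp add: m_def)
  define w where "w = v' $ m"
  define d where "d i j = C $$ (i, j) - C' $$ (i, j)" for i j
  define t where "t i = w * (r $ i - r' $ i) + (\<Sum>j<m. d i j * (v' $ j - w))" for i
  have dim: "dim_vec v = n" "dim_vec v' = n"
    using assms by (auto simp: left_eigenvector_def eigenvector_def)
  have w: "w \<ge> 0" and v': "\<And>j. j < m \<Longrightarrow> v' $ j \<ge> w"
    using \<open>rooted v'\<close> dim n by (auto simp: rooted_def w_def)
  have v: "v $ i \<ge> 0" if "i < n" for i
    using \<open>nonneg_vec v\<close> dim that by (simp add: nonneg_vec_def)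
  have d: "d i j \<ge> 0" if "i < n" "j < m" for i j
    using assms(6) that by (simp add: d_def m_def)
  have r: "r $ i - r' $ i \<ge> 0" if "i < n" for i
    using assms(7) that by simp
  have summand: "d i j * (v' $ j - w) \<ge> 0" if "i < n" "j < m" for i j
    using d[OF that] v'[OF that(2)] by simp
  have row_nonneg: "w * (r $ i - r' $ i) \<ge> 0" if "i < n" for i
    using w r[OF that] by simp
  have inner_nonneg: "(\<Sum>j<m. d i j * (v' $ j - w)) \<ge> 0" if "i < n" for i
    using summand[OF that] by (intro sum_nonneg) simp
  have t_nonneg: "t i \<ge> 0" if "i < n" for i
    using row_nonneg[OF that] inner_nonneg[OF that] by (simp add: t_def)
  \<comment> \<open>The definition of \<open>t\<close> displays its sign; this form is entry
    \<open>i\<close> of \<open>(C - C') v'\<close>, as the eigenvector identity requires.\<close>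
  have t_eq: "t i = (\<Sum>j<n. d i j * v' $ j)" if "i < n" for i
  proof -
    have "r $ i - r' $ i = (\<Sum>j<n. d i j)"
      using assms(2-5) that by (simp add: row_sum_vec_def d_def sum_subtractf)
    then show ?thesis
      unfolding t_def w_def n sum_mult_shift_last by simp
  qed
  have main: "(l - l') * (v \<bullet> v') = (\<Sum>i<n. v $ i * t i)"
    using left_right_eigenvector_diff[OF assms(2,3,10,8)] by (simp add: t_eq d_def)
  have nonneg: "v $ i * t i \<ge> 0" if "i < n" for i
    using v t_nonneg that by simp
  have "(l - l') * (v \<bullet> v') \<ge> 0"
    unfolding main using nonneg by (intro sum_nonneg) simp
  then have "l \<ge> l'"
    using assms(12) by (simp add: zero_le_mult_iff)
  \<comment> \<open>These are conditions (a) and (b) for a single row \<open>i\<close>, still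
    without the restriction to \<open>v $ i \<noteq> 0\<close>.\<close>
  have t_0: "t i = 0 \<longleftrightarrow> (w \<noteq> 0 \<longrightarrow> r $ i = r' $ i) \<and> (\<forall>j<m. v' $ j > w \<longrightarrow> C' $$ (i, j) = C $$ (i, j))"
    if "i < n" for i
  proof -
    have "t i = 0 \<longleftrightarrow> w * (r $ i - r' $ i) = 0 \<and> (\<Sum>j<m. d i j * (v' $ j - w)) = 0"
      unfolding t_def by (rule add_nonneg_eq_0_iff[OF row_nonneg inner_nonneg]) (use that in auto)
    also have "(\<Sum>j<m. d i j * (v' $ j - w)) = 0 \<longleftrightarrow> (\<forall>j<m. d i j * (v' $ j - w) = 0)"
      using summand[OF that] by (subst sum_nonneg_eq_0_iff) auto
    \<comment> \<open>Rootedness leaves two cases: if \<open>v' $ j = w\<close> the product is zero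
      anyway, and if \<open>v' $ j > w\<close> then \<open>d i j\<close> itself must be
      zero.\<close>
    also have "\<dots> \<longleftrightarrow> (\<forall>j<m. v' $ j > w \<longrightarrow> C' $$ (i, j) = C $$ (i, j))"
      using v' by (force simp: d_def less_le)
    finally show ?thesis by auto
  qed
  \<comment> \<open>The factor \<open>v \<bullet> v'\<close> is positive, so it can be cancelled in
    \<open>main\<close>.\<close>
  have "l = l' \<longleftrightarrow> (\<Sum>i<n. v $ i * t i) = 0"
    using main[symmetric] assms(12) by simp
  also have "\<dots> \<longleftrightarrow> (\<forall>i<n. v $ i \<noteq> 0 \<longrightarrow> t i = 0)"
    using nonneg by (subst sum_nonneg_eq_0_iff) auto
  finally show ?thesis
    using \<open>l \<ge> l'\<close> t_0 unfolding m_def[symmetric] w_def[symmetric] by blast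
qed

end
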